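(* Let $\{B_n^c(s)\}_{n\ge0}$ be the sequence of polynomials defined by $$\sum_{n\ge0}B_n^c(s)\frac{z^n}{n!}=\frac{e^z-1}{z}\,e^{sz}$$ (the cognate sequence of the Bernoulli polynomials $B_n(s)$). Then for every $n\ge1$ all zeros of $B_n^c(s)$ lie on the line $\operatorname{Re}s=-\frac12$.
   Context: For a sequence of polynomials $\{G_n(s)\}$ with $\sum_{n\ge0}G_n(s)z^n/n!=g(z)e^{sf(z)}$, where $g,f$ are power series with $g(0)\neq0$, $f(0)=0$, $f'(0)\neq0$ (the Sheffer sequence for the pair $(g,f)$), the cognate sequence $\{G_n^c(s)\}$ is defined by $\sum_{n\ge0}G_n^c(s)z^n/n!=\frac{f'(z)}{g(z)}e^{sf(z)}$. The Bernoulli polynomials are the case $g(z)=z/(e^z-1)$, $f(z)=z$. *)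

theory Defs
  imports Complex_Main "HOL-Computational_Algebra.Computational_Algebra"
begin

unbundle fps_syntax

definition sheffer_pair :: "complex fps \<Rightarrow> complex fps \<Rightarrow> bool" where
  "sheffer_pair g f \<longleftrightarrow> g $ 0 \<noteq> 0 \<and> f $ 0 = 0 \<and> fps_deriv f $ 0 \<noteq> 0"

(* The series in z with coefficients G_n(s)/n!, at a fixed complex number s.
   An identity of such series for all s is the same as an identity of formal power
   series in z over the polynomials in s. *)
definition poly_egf :: "(nat \<Rightarrow> complex poly) \<Rightarrow> complex \<Rightarrow> complex fps" where
  "poly_egf G s = Abs_fps (\<lambda>n. poly (G n) s / fact n)"

(* fps_exp s oo f is the formal power series e^(s f(z)). *)
definition sheffer_seq :: "complex fps \<Rightarrow> complex fps \<Rightarrow> (nat \<Rightarrow> complex poly) \<Rightarrow> bool" where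
  "sheffer_seq g f G \<longleftrightarrow> sheffer_pair g f \<and> (\<forall>s. poly_egf G s = g * (fps_exp s oo f))"

(* The pair (g, f) is determined by G: the case s = 0 gives g, and then s = 1 gives f. *)
definition cognate_of :: "(nat \<Rightarrow> complex poly) \<Rightarrow> (nat \<Rightarrow> complex poly) \<Rightarrow> bool" where
  "cognate_of G Gc \<longleftrightarrow>
     (\<exists>g f. sheffer_seq g f G \<and> (\<forall>s. poly_egf Gc s = fps_deriv f / g * (fps_exp s oo f)))"

(* Dividing by a series without constant term is meaningful here: both z and e^z - 1 have
   order 1, and division of formal power series cancels the common factor z. *)
definition bernoulli_polys :: "(nat \<Rightarrow> complex poly) \<Rightarrow> bool" where
  "bernoulli_polys B \<longleftrightarrow> sheffer_seq (fps_X / (fps_exp 1 - 1)) fps_X B"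

lemma poly_egf_ex1:
  "\<exists>!G. \<forall>s. poly_egf G s = h * (fps_exp s oo f)"
proof -
  define G where "G = (\<lambda>n. \<Sum>i=0..n. \<Sum>k=0..n-i.
      monom (fact n * h $ i * (f ^ k $ (n - i)) / fact k) k)"
  have "poly_egf G s = h * (fps_exp s oo f)" for s
    by (rule fps_ext)
       (simp add: poly_egf_def G_def fps_mult_nth fps_compose_nth poly_sum poly_monom
          sum_distrib_left sum_divide_distrib mult_ac)
  moreover have "G1 = G2"
    if "\<forall>s. poly_egf G1 s = h * (fps_exp s oo f)" "\<forall>s. poly_egf G2 s = h * (fps_exp s oo f)"
    for G1 G2
  proof
    fix n
    have "poly (G1 n) s = poly (G2 n) s" for s
    proof -
      have "poly_egf G1 s $ n = poly_egf G2 s $ n"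
        using that by simp
      then show ?thesis
        by (simp add: poly_egf_def)
    qed
    then show "G1 n = G2 n"
      by (simp add: poly_eq_poly_eq_iff[symmetric] fun_eq_iff)
  qed
  ultimately show ?thesis
    by blast
qed

lemma sheffer_pair_bernoulli: "sheffer_pair (fps_X / (fps_exp 1 - 1)) fps_X"
proof -
  define h :: "complex fps" where "h = Abs_fps (\<lambda>n. 1 / fact (Suc n))"
  have h0: "h $ 0 \<noteq> 0"
    by (simp add: h_def)
  have "(fps_exp 1 - 1 :: complex fps) = fps_X * h"
    by (rule fps_ext) (auto simp: h_def gr0_conv_Suc)
  then have "fps_X / (fps_exp 1 - 1) = (fps_X * 1) div (fps_X * h)"
    by simp
  also have "\<dots> = 1 div h"
    by (subst div_mult_mult1) auto
  also have "\<dots> = inverse h"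
    using h0 by (simp add: fps_divide_unit)
  finally show ?thesis
    using h0 by (simp add: sheffer_pair_def)
qed

lemma bernoulli_polys_ex1: "\<exists>!B. bernoulli_polys B"
  using poly_egf_ex1[of "fps_X / (fps_exp 1 - 1)" fps_X] sheffer_pair_bernoulli
  by (simp add: bernoulli_polys_def sheffer_seq_def)

end

theory Submission imports Defs begin

text \<open>
  Multiplying the generating function by \<open>z\<close> gives \<open>e\<^bsup>(s+1)z\<^esup> - e\<^bsup>sz\<^esup>\<close>, so the cognate polynomials are
  \<open>((s + 1)\<^bsup>n+1\<^esup> - s\<^bsup>n+1\<^esup>) / (n + 1)\<close>. A zero therefore has the same distance from \<open>-1\<close> as from \<open>0\<close>.
\<close>

text \<open>The cofactor \<open>h\<close> has nonzero constant term, so it is a unit. Cancelling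
  \<open>fps_X\<close> thus reduces quotients of these order-1 series to \<open>h\<close> or
  \<open>inverse h\<close>.\<close>

lemma fps_exp_minus_1_factor:
  obtains h :: "complex fps"
  where "h $ 0 \<noteq> 0" "fps_exp 1 - 1 = fps_X * h"
proof
  let ?h = "Abs_fps (\<lambda>n. 1 / fact (Suc n)) :: complex fps"
  show "?h $ 0 \<noteq> 0"
    by simp
  show "fps_exp 1 - 1 = fps_X * ?h"
    by (rule fps_ext) (auto simp: gr0_conv_Suc)
qed

text \<open>Power series form no field, so a quotient cannot simply be inverted. Instead both sides
  are computed to be the unit \<open>h\<close>.\<close>

lemma inverse_bernoulli_factor:
  "1 / (fps_X / (fps_exp 1 - 1)) = (fps_exp 1 - 1) / (fps_X :: complex fps)"
proof -
  obtain h :: "complex fps" where h: "h $ 0 \<noteq> 0" "fps_exp 1 - 1 = fps_X * h"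
    by (rule fps_exp_minus_1_factor)
  then have quot: "(fps_exp 1 - 1) / fps_X = h"
    by (metis fps_X_neq_zero nonzero_mult_div_cancel_left)
  have "fps_X / (fps_exp 1 - 1) = (fps_X * 1) div (fps_X * h)"
    by (simp add: h(2))
  also have "\<dots> = inverse h"
    using h(1) by (subst div_mult_mult1) (auto simp: fps_divide_unit)
  finally show ?thesis
    using h(1) by (simp only: quot) (simp add: fps_divide_unit)
qed

text \<open>The witnesses are the defining pair of the Bernoulli polynomials. As
  \<open>fps_X\<close> has derivative 1, the cognate prefactor is the reciprocal of the Bernoulli
  one.\<close>

lemma cognate_of_bernoulli:
  assumes "bernoulli_polys B"
    and "\<And>s. poly_egf Bc s = (fps_exp 1 - 1) / fps_X * fps_exp s"
  shows "cognate_of B Bc"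
  unfolding cognate_of_def
proof (intro exI conjI)
  show "sheffer_seq (fps_X / (fps_exp 1 - 1)) fps_X B"
    using assms(1) by (simp add: bernoulli_polys_def)
  show "\<forall>s. poly_egf Bc s =
      fps_deriv fps_X / (fps_X / (fps_exp 1 - 1)) * (fps_exp s oo fps_X)"
    by (simp add: assms(2) inverse_bernoulli_factor)
qed

lemma cognate_bernoulli_eq:
  assumes "\<And>s. poly_egf Bc s = (fps_exp 1 - 1) / fps_X * fps_exp s"
  shows "poly (Bc n) s = ((s + 1) ^ Suc n - s ^ Suc n) / of_nat (Suc n)"
proof -
  obtain h :: "complex fps" where h: "fps_exp 1 - 1 = fps_X * h"
    by (rule fps_exp_minus_1_factor)
  then have "(fps_exp 1 - 1) / fps_X = h"
    by (metis fps_X_neq_zero nonzero_mult_div_cancel_left)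
  then have "fps_X * poly_egf Bc s = (fps_exp 1 - 1) * fps_exp s"
    by (simp only: assms h mult.assoc)
  also have "\<dots> = fps_exp (s + 1) - fps_exp s"
    by (simp add: fps_exp_add_mult algebra_simps)
  \<comment> \<open>The factor \<open>fps_X\<close> shifts coefficients by one, so index
    \<open>Suc n\<close> isolates \<open>Bc n\<close>.\<close>
  finally have "(fps_X * poly_egf Bc s) $ Suc n = (fps_exp (s + 1) - fps_exp s) $ Suc n"
    by simp
  then have *: "poly (Bc n) s / fact n = ((s + 1) ^ Suc n - s ^ Suc n) / fact (Suc n)"
    by (simp add: poly_egf_def diff_divide_distrib del: fact_Suc power_Suc)
  have "poly (Bc n) s = fact n * (poly (Bc n) s / fact n)"
    by simp
  also have "\<dots> = ((s + 1) ^ Suc n - s ^ Suc n) / of_nat (Suc n)"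
    unfolding * by (simp del: power_Suc of_nat_Suc)
  finally show ?thesis .
qed

lemma Re_of_power_eq:
  fixes s :: complex
  assumes "(s + 1) ^ Suc n = s ^ Suc n"
  shows "Re s = - 1 / 2"
proof -
  have "norm (s + 1) ^ Suc n = norm s ^ Suc n"
    using assms by (metis norm_power)
  then have "norm (s + 1) = norm s"
    by (rule power_inject_base) simp_all
  then have "(norm (s + 1))\<^sup>2 = (norm s)\<^sup>2"
    by simp
  \<comment> \<open>The two squared norms differ by \<open>2 * Re s + 1\<close>.\<close>
  then show ?thesis
    by (simp add: cmod_power2 power2_sum)
qed

theorem theorem2:
  fixes Bc :: "nat \<Rightarrow> complex poly"
  assumes "\<And>s. poly_egf Bc s = (fps_exp 1 - 1) / fps_X * fps_exp s"
  shows "(\<forall>B. bernoulli_polys B \<longrightarrow> cognate_of B Bc) \<and>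
         (\<forall>n\<ge>1. \<forall>s. poly (Bc n) s = 0 \<longrightarrow> Re s = - 1 / 2)"
proof (intro conjI allI impI)
  show "cognate_of B Bc" if "bernoulli_polys B" for B
    using that assms by (rule cognate_of_bernoulli)
  show "Re s = - 1 / 2" if "poly (Bc n) s = 0" for n s
  proof (rule Re_of_power_eq)
    show "(s + 1) ^ Suc n = s ^ Suc n"
      using that cognate_bernoulli_eq[OF assms, of n s]
      by (simp del: power_Suc of_nat_Suc)
  qed
qed

end
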